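(* Let $G$ be a graph with an odd number $n\geq 9$ of vertices. Then $\mathrm{mp}(G)=2n-4$ if and only if $G=K_n-e$ for some edge $e\in E(K_n)$.
   Context: All graphs are finite, simple and undirected; $K_n-e$ is the complete graph on $n$ vertices with one edge removed. A perfect matching is a set of edges covering every vertex exactly once; an almost-perfect matching is a set of edges covering every vertex except one exactly once and missing the remaining vertex. The matching preclusion number $\mathrm{mp}(G)$ is the minimum number of edges whose deletion leaves a graph with neither a perfect matching nor an almost-perfect matching ($\mathrm{mp}(G)=0$ if $G$ has neither). *)

theory Defs
  imports Main
begin

text \<open>
  Undirected graphs with edges as two-element vertex sets, so that \<open>card\<close> of a set of edges
  counts each undirected edge once (in a symmetric digraph it would be counted twice).
\<close>

record 'a ugraph =
  verts :: "'a set"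
  edges :: "'a set set"

definition all_edges :: "'a set \<Rightarrow> 'a set set" where
  "all_edges V = {e. e \<subseteq> V \<and> card e = 2}"

definition simple_graph :: "'a ugraph \<Rightarrow> bool" where
  "simple_graph G \<longleftrightarrow> finite (verts G) \<and> edges G \<subseteq> all_edges (verts G)"

definition complete_graph :: "'a set \<Rightarrow> 'a ugraph" where
  "complete_graph V = \<lparr>verts = V, edges = all_edges V\<rparr>"

definition delete_edges :: "'a ugraph \<Rightarrow> 'a set set \<Rightarrow> 'a ugraph" where
  "delete_edges G F = \<lparr>verts = verts G, edges = edges G - F\<rparr>"

definition perfect_matching :: "'a ugraph \<Rightarrow> 'a set set \<Rightarrow> bool" where
  "perfect_matching G M \<longleftrightarrow> M \<subseteq> edges G \<and> (\<forall>v\<in>verts G. \<exists>!e. e \<in> M \<and> v \<in> e)"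

definition almost_perfect_matching :: "'a ugraph \<Rightarrow> 'a set set \<Rightarrow> bool" where
  "almost_perfect_matching G M \<longleftrightarrow> M \<subseteq> edges G \<and>
     (\<exists>w\<in>verts G. (\<forall>e\<in>M. w \<notin> e) \<and> (\<forall>v\<in>verts G - {w}. \<exists>!e. e \<in> M \<and> v \<in> e))"

definition matching_precluding :: "'a ugraph \<Rightarrow> 'a set set \<Rightarrow> bool" where
  "matching_precluding G F \<longleftrightarrow> F \<subseteq> edges G \<and>
     \<not> (\<exists>M. perfect_matching (delete_edges G F) M) \<and>
     \<not> (\<exists>M. almost_perfect_matching (delete_edges G F) M)"

text \<open>
  If \<open>G\<close> itself has neither kind of matching, the empty set is precluding and the minimum is 0.
  A simple graph with at least two vertices has a precluding set, namely the set of all its edges;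
  with at most one vertex the empty matching always survives, no precluding set exists,
  and the value below is unspecified.
\<close>

definition mp :: "'a ugraph \<Rightarrow> nat" where
  "mp G = (LEAST k. \<exists>F. matching_precluding G F \<and> card F = k)"

end

theory Submission
  imports Defs
begin

text \<open>
  The heart of the matter is that a graph on an odd number \<open>n \<ge> 9\<close> of vertices without an
  almost-perfect matching misses at least \<open>2n - 3\<close> edges. Take a maximum matching \<open>M\<close>, of size
  \<open>k\<close>, with set \<open>U\<close> of uncovered vertices, \<open>u = |U| = n - 2k \<ge> 3\<close>. Then \<open>U\<close> is independent, and
  as there is no augmenting path of length 3, at least \<open>u\<close> edges are missing between each edge
  of \<open>M\<close> and \<open>U\<close>; this suffices for \<open>u \<ge> 5\<close>. If \<open>u = 3\<close>, we are done when always four such edges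
  are missing. Otherwise some \<open>x y \<in> M\<close> has \<open>x\<close> adjacent to all of \<open>U\<close>, and augmenting paths of
  length 5 through \<open>x y\<close> yield further missing edges at \<open>y\<close>, one for each other edge of \<open>M\<close>.

  Deleting all edges at two vertices destroys every almost-perfect matching, at a cost of
  \<open>2n - 3\<close> minus the number of already missing edges at these vertices. So \<open>mp G = 2n - 4\<close>
  forces a missing edge, and two missing edges can be met by two vertices, giving
  \<open>mp G \<le> 2n - 5\<close>.
\<close>

section \<open>Two-element edges and counting over disjoint families\<close>

lemma finite_all_edges: "finite V \<Longrightarrow> finite (all_edges V)"
  unfolding all_edges_def by simp

lemma card_all_edges: "finite V \<Longrightarrow> card (all_edges V) = card V choose 2"
  unfolding all_edges_def by (rule n_subsets)

lemma pair_in_all_edges: "{x, y} \<in> all_edges V \<longleftrightarrow> x \<in> V \<and> y \<in> V \<and> x \<noteq> y"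
  unfolding all_edges_def by (auto simp: card_insert_if)

lemma card_two_not_three_parts:
  assumes "card e = 2" "e \<inter> A \<noteq> {}" "e \<inter> B \<noteq> {}" "e \<inter> C \<noteq> {}"
    and "A \<inter> B = {}" "A \<inter> C = {}" "B \<inter> C = {}"
  shows False
proof -
  obtain p q where "e = {p, q}" using assms(1) by (auto simp: card_2_iff)
  then show False using assms(2-) by auto
qed

lemma card_pair_image: "x \<notin> S \<Longrightarrow> card ((\<lambda>a. {x, a}) ` S) = card S"
  by (rule card_image) (auto simp: inj_on_def doubleton_eq_iff)

lemma pairwise_disjnt_three:
  assumes "disjnt A B" "disjnt A C" "disjnt B C"
  shows "pairwise disjnt {A, B, C}"
proof -
  have "disjnt B A" "disjnt C A" "disjnt C B" using assms disjnt_sym by auto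
  then show ?thesis using assms by (simp add: pairwise_def)
qed

text \<open>The accounting scheme for both counts of missing edges: \<open>A\<close> will hold the
  pairs inside the uncovered set, \<open>P i\<close> the missing edges charged to the matching edge
  \<open>i\<close>, and \<open>B\<close> is room for one additional missing edge.\<close>

lemma card_ge_disjoint_UN:
  assumes "finite N" "finite I" "A \<subseteq> N" "B \<subseteq> N" "\<And>i. i \<in> I \<Longrightarrow> P i \<subseteq> N"
    and "\<And>i j. i \<in> I \<Longrightarrow> j \<in> I \<Longrightarrow> i \<noteq> j \<Longrightarrow> P i \<inter> P j = {}"
    and "\<And>i. i \<in> I \<Longrightarrow> A \<inter> P i = {}" "\<And>i. i \<in> I \<Longrightarrow> B \<inter> P i = {}" "A \<inter> B = {}"
  shows "card A + card B + (\<Sum>i\<in>I. card (P i)) \<le> card N"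
proof -
  have fin: "finite A" "finite B" "\<And>i. i \<in> I \<Longrightarrow> finite (P i)"
    using assms(1,3-5) finite_subset by metis+
  have "card (A \<union> B \<union> (\<Union>i\<in>I. P i)) = card (A \<union> B) + card (\<Union>i\<in>I. P i)"
  proof (rule card_Un_disjoint)
    show "(A \<union> B) \<inter> (\<Union>i\<in>I. P i) = {}" using assms(7,8) by blast
  qed (use fin assms(2) in auto)
  also have "card (A \<union> B) = card A + card B"
    by (rule card_Un_disjoint) (use fin assms in auto)
  also have "card (\<Union>i\<in>I. P i) = (\<Sum>i\<in>I. card (P i))"
    by (rule card_UN_disjoint) (use fin assms in auto)
  finally have "card A + card B + (\<Sum>i\<in>I. card (P i)) = card (A \<union> B \<union> (\<Union>i\<in>I. P i))" by simp
  also have "\<dots> \<le> card N"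
    by (rule card_mono) (use assms in auto)
  finally show ?thesis .
qed

section \<open>Maximum matchings and augmenting paths\<close>

locale maximum_matching =
  fixes V :: "'a set" and E M :: "'a set set"
  assumes finite_V: "finite V"
    and E_subset: "E \<subseteq> all_edges V"
    and M_subset: "M \<subseteq> E"
    and disjoint_M: "pairwise disjnt M"
    and maximum: "\<And>M'. M' \<subseteq> E \<Longrightarrow> pairwise disjnt M' \<Longrightarrow> card M' \<le> card M"
begin

definition U where "U = V - \<Union>M"

definition missing where "missing = all_edges V - E"

text \<open>The target set \<open>S\<close> is a parameter because the case of three uncovered
  vertices enlarges \<open>U\<close> by one covered vertex.\<close>

definition missing_to :: "'a set \<Rightarrow> 'a set \<Rightarrow> 'a set set" where
  "missing_to S m = {e \<in> missing. e \<inter> m \<noteq> {} \<and> e \<inter> S \<noteq> {}}"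

lemma finite_E: "finite E"
  using E_subset finite_all_edges[OF finite_V] finite_subset by blast

lemma finite_M: "finite M"
  using M_subset finite_E finite_subset by blast

lemma finite_U: "finite U"
  unfolding U_def using finite_V by simp

lemma finite_missing: "finite missing"
  unfolding missing_def using finite_all_edges[OF finite_V] by simp

lemma card_edge: "e \<in> E \<Longrightarrow> card e = 2"
  using E_subset unfolding all_edges_def by auto

lemma edge_in_V: "e \<in> E \<Longrightarrow> e \<subseteq> V"
  using E_subset unfolding all_edges_def by auto

lemma M_in_V: "\<Union>M \<subseteq> V"
  using M_subset edge_in_V by blast

lemma M_disjoint: "m \<in> M \<Longrightarrow> m' \<in> M \<Longrightarrow> m \<noteq> m' \<Longrightarrow> m \<inter> m' = {}"
  using disjoint_M by (auto simp: pairwise_def disjnt_def)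

lemma M_U_disjoint: "m \<in> M \<Longrightarrow> m \<inter> U = {}"
  unfolding U_def by auto

lemma missing_to_subset: "missing_to S m \<subseteq> missing"
  unfolding missing_to_def by auto

lemma finite_missing_to: "finite (missing_to S m)"
  using finite_missing missing_to_subset finite_subset by blast

lemma card_missing_edge: "e \<in> missing \<Longrightarrow> card e = 2"
  unfolding missing_def all_edges_def by auto

lemma pair_missing: "x \<in> V \<Longrightarrow> y \<in> V \<Longrightarrow> x \<noteq> y \<Longrightarrow> {x, y} \<notin> E \<Longrightarrow> {x, y} \<in> missing"
  unfolding missing_def by (simp add: pair_in_all_edges)

lemma card_V: "card V = 2 * card M + card U"
proof -
  have "card (\<Union>M) = (\<Sum>m\<in>M. card m)"
    by (rule card_Union_disjoint[OF disjoint_M]) (use M_subset card_edge card.infinite in force)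
  also have "\<dots> = (\<Sum>m\<in>M. 2)"
    by (rule sum.cong) (use M_subset card_edge in auto)
  finally have "card (\<Union>M) = 2 * card M" by simp
  moreover have "card V = card (\<Union>M) + card U"
    unfolding U_def using M_in_V finite_V
    by (metis card_Diff_subset card_mono finite_subset le_add_diff_inverse)
  ultimately show ?thesis by simp
qed

text \<open>Edges of \<open>A\<close> use only uncovered vertices and vertices freed by removing
  \<open>D\<close>, so trading \<open>D\<close> for \<open>A\<close> gives another matching, and
  maximality applies. Taking \<open>D\<close> with 0, 1 or 2 edges excludes augmenting paths of
  length 1, 3 and 5.\<close>

lemma exchange:
  assumes "D \<subseteq> M" "A \<subseteq> E" "pairwise disjnt A" "\<Union>A \<subseteq> U \<union> \<Union>D"
  shows "card A \<le> card D"
proof -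
  have sep: "a \<inter> m = {}" if "a \<in> A" "m \<in> M - D" for a m
  proof -
    have "U \<inter> m = {}" using that M_U_disjoint by blast
    moreover have "\<Union>D \<inter> m = {}" using that M_disjoint assms(1) by blast
    ultimately show ?thesis using assms(4) that by blast
  qed
  \<comment> \<open>An edge common to \<open>A\<close> and \<open>M - D\<close> would be disjoint
    from itself; nonemptiness rules this out, so the cardinalities add up.\<close>
  have ne: "a \<noteq> {}" if "a \<in> A" for a
    using that assms(2) card_edge by force
  have fin: "finite A" "finite D"
    using assms finite_E finite_M finite_subset by metis+
  have "pairwise disjnt ((M - D) \<union> A)"
    using disjoint_M assms(3) sep unfolding pairwise_def disjnt_def by blast
  moreover have "(M - D) \<union> A \<subseteq> E"
    using assms(2) M_subset by blast
  ultimately have "card ((M - D) \<union> A) \<le> card M"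
    by (intro maximum)
  moreover have "card ((M - D) \<union> A) = card (M - D) + card A"
  proof (rule card_Un_disjoint)
    show "(M - D) \<inter> A = {}"
    proof (rule equals0I)
      fix e assume "e \<in> (M - D) \<inter> A"
      then show False using sep[of e e] ne[of e] by simp
    qed
  qed (use fin finite_M in auto)
  moreover have "card (M - D) = card M - card D"
    using assms(1) fin by (simp add: card_Diff_subset)
  moreover have "card D \<le> card M" using assms(1) finite_M by (simp add: card_mono)
  ultimately show ?thesis by linarith
qed

lemma U_independent:
  assumes "a \<in> U" "b \<in> U"
  shows "{a, b} \<notin> E"
proof
  assume "{a, b} \<in> E"
  then have "card {{a, b}} \<le> card ({} :: 'a set set)"
    by (intro exchange) (use assms in auto)
  then show False by simp
qed

text \<open>The path is a, x, y, b: its two outer edges would replace the single matching edge in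
  the middle.\<close>

lemma no_augmenting_path_3:
  assumes "{x, y} \<in> M" "a \<in> U" "b \<in> U" "a \<noteq> b"
  shows "\<not> ({x, a} \<in> E \<and> {y, b} \<in> E)"
proof
  assume *: "{x, a} \<in> E \<and> {y, b} \<in> E"
  have xy: "x \<noteq> y" using assms(1) M_subset card_edge by fastforce
  have nU: "x \<notin> U" "y \<notin> U" using M_U_disjoint[OF assms(1)] by auto
  have "card {{x, a}, {y, b}} \<le> card {{x, y}}"
    by (rule exchange) (use assms * xy nU in \<open>auto simp: pairwise_def disjnt_def\<close>)
  moreover have "{x, a} \<noteq> {y, b}" using assms xy nU by (auto simp: doubleton_eq_iff)
  ultimately show False by simp
qed

text \<open>The path is a, x, y, y', x', b: three edges would replace the two matching
  edges.\<close>

lemma no_augmenting_path_5: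
  assumes "{x, y} \<in> M" "{x', y'} \<in> M" "{x, y} \<noteq> {x', y'}" "a \<in> U" "b \<in> U" "a \<noteq> b"
    and "{x, a} \<in> E" "{x', b} \<in> E"
  shows "{y, y'} \<notin> E"
proof
  assume *: "{y, y'} \<in> E"
  have xy: "x \<noteq> y" "x' \<noteq> y'" using assms(1,2) M_subset card_edge by fastforce+
  have nU: "x \<notin> U" "y \<notin> U" "x' \<notin> U" "y' \<notin> U"
    using M_U_disjoint[OF assms(1)] M_U_disjoint[OF assms(2)] by auto
  have d: "x \<noteq> x'" "x \<noteq> y'" "y \<noteq> x'" "y \<noteq> y'"
    using M_disjoint[OF assms(1-3)] by auto
  have ab: "a \<noteq> x" "a \<noteq> y" "a \<noteq> x'" "a \<noteq> y'" "b \<noteq> x" "b \<noteq> y" "b \<noteq> x'" "b \<noteq> y'"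
    using assms(4,5) nU by auto
  note neqs = xy d ab xy[symmetric] d[symmetric] ab[symmetric] assms(6) assms(6)[symmetric]
  have "card {{x, a}, {x', b}, {y, y'}} \<le> card {{x, y}, {x', y'}}"
  proof (rule exchange)
    show "pairwise disjnt {{x, a}, {x', b}, {y, y'}}"
      by (rule pairwise_disjnt_three) (use neqs in \<open>simp_all add: disjnt_def\<close>)
    show "\<Union>{{x, a}, {x', b}, {y, y'}} \<subseteq> U \<union> \<Union>{{x, y}, {x', y'}}"
      using assms(4,5) by simp
  qed (use assms(1,2,7,8) * in simp_all)
  moreover have "card {{x, a}, {x', b}, {y, y'}} = 3"
    using neqs by (simp add: doubleton_eq_iff card_insert_if)
  moreover have "card {{x, y}, {x', y'}} \<le> 2"
    by (simp add: card_insert_if)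
  ultimately show False by simp
qed

section \<open>Missing edges at the uncovered vertices\<close>

lemma all_edges_U_missing: "all_edges U \<subseteq> missing"
proof
  fix e assume e: "e \<in> all_edges U"
  then obtain a b where ab: "e = {a, b}" by (auto simp: all_edges_def card_2_iff)
  with e have "a \<in> U" "b \<in> U" "a \<noteq> b" by (auto simp: pair_in_all_edges)
  then show "e \<in> missing"
    using U_independent ab by (auto intro!: pair_missing simp: U_def)
qed

lemma M_edgeE:
  assumes "m \<in> M"
  obtains x y where "m = {x, y}" "x \<noteq> y" "x \<in> V" "y \<in> V" "x \<notin> U" "y \<notin> U"
proof -
  obtain x y where "m = {x, y}" "x \<noteq> y"
    using assms M_subset card_edge by (meson card_2_iff subsetD)
  with that show ?thesis using assms M_in_V M_U_disjoint by blast
qed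

lemma star_missing_to:
  assumes "m \<in> M" "x \<in> m" "S \<subseteq> U" "\<And>a. a \<in> S \<Longrightarrow> {x, a} \<notin> E"
  shows "(\<lambda>a. {x, a}) ` S \<subseteq> missing_to U m"
proof -
  have "x \<in> V" "x \<notin> U" using assms M_in_V M_U_disjoint by blast+
  then have "{x, a} \<in> missing" if "a \<in> S" for a
    using that assms by (intro pair_missing) (auto simp: U_def)
  then show ?thesis using assms unfolding missing_to_def by auto
qed

lemma card_missing_to_ge_two_stars:
  assumes "{x, y} \<in> M" "x \<noteq> y" "S \<subseteq> U" "T \<subseteq> U"
    and "\<And>a. a \<in> S \<Longrightarrow> {x, a} \<notin> E" "\<And>a. a \<in> T \<Longrightarrow> {y, a} \<notin> E"
  shows "card S + card T \<le> card (missing_to U {x, y})"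
proof -
  have nU: "x \<notin> U" "y \<notin> U" using M_U_disjoint[OF assms(1)] by auto
  have fin: "finite S" "finite T" using assms finite_U finite_subset by metis+
  have "card S + card T = card ((\<lambda>a. {x, a}) ` S) + card ((\<lambda>a. {y, a}) ` T)"
    using nU assms by (subst (1 2) card_pair_image) auto
  also have "\<dots> = card ((\<lambda>a. {x, a}) ` S \<union> (\<lambda>a. {y, a}) ` T)"
    by (rule card_Un_disjoint[symmetric])
       (use fin nU assms in \<open>auto simp: doubleton_eq_iff\<close>)
  also have "\<dots> \<le> card (missing_to U {x, y})"
    by (rule card_mono[OF finite_missing_to])
       (use star_missing_to[OF assms(1), of x S] star_missing_to[OF assms(1), of y T] assms
         in auto)
  finally show ?thesis .
qed

text \<open>If both ends of \<open>m\<close> have neighbours in \<open>U\<close>, the absence of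
  augmenting paths of length 3 forces all these neighbours to be one vertex \<open>a\<close>, so
  each end misses \<open>U - {a}\<close>. Otherwise one end, named \<open>y\<close>, misses all of
  \<open>U\<close>.\<close>

lemma missing_to_dichotomy:
  assumes "m \<in> M"
  obtains (big) "2 * (card U - 1) \<le> card (missing_to U m)"
  | (star) x y where "m = {x, y}" "x \<noteq> y" "\<And>a. a \<in> U \<Longrightarrow> {y, a} \<notin> E"
proof -
  obtain x y where m: "m = {x, y}" "x \<noteq> y" using M_edgeE[OF assms] by metis
  show thesis
  proof (cases "(\<exists>a\<in>U. {x, a} \<in> E) \<and> (\<exists>b\<in>U. {y, b} \<in> E)")
    case True
    then obtain a b where ab: "a \<in> U" "{x, a} \<in> E" "b \<in> U" "{y, b} \<in> E" by blast
    have M1: "{x, y} \<in> M" using assms m by simp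
    have "a = b" using no_augmenting_path_3[OF M1] ab by blast
    then have "{x, c} \<notin> E" "{y, c} \<notin> E" if "c \<in> U - {a}" for c
      using no_augmenting_path_3[OF M1] ab that by blast+
    then have "card (U - {a}) + card (U - {a}) \<le> card (missing_to U {x, y})"
      by (intro card_missing_to_ge_two_stars[OF M1 m(2)]) auto
    then show ?thesis using ab finite_U m by (intro big) simp
  next
    case False
    then show ?thesis using m star[of x y] star[of y x] by (auto simp: insert_commute)
  qed
qed

lemma card_missing_to_ge:
  assumes "m \<in> M" "card U \<ge> 2"
  shows "card U \<le> card (missing_to U m)"
  using assms(1)
proof (cases rule: missing_to_dichotomy)
  case big
  then show ?thesis using assms by linarith
next
  case (star x y)
  then show ?thesis
    using card_missing_to_ge_two_stars[of x y "{}" U] assms by auto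
qed

text \<open>This is the equality case of \<open>card_missing_to_ge\<close>. For u >= 3 we have 2(u -
  1) > u, which leaves only the star case; there \<open>y\<close> already accounts for u missing
  edges, so none remains for \<open>x\<close>.\<close>

lemma full_vertex:
  assumes "m \<in> M" "card U \<ge> 3" "card (missing_to U m) \<le> card U"
  obtains x y where "m = {x, y}" "x \<noteq> y" "\<And>a. a \<in> U \<Longrightarrow> {x, a} \<in> E"
  using assms(1)
proof (cases rule: missing_to_dichotomy)
  case big
  then show ?thesis using assms by linarith
next
  case (star x y)
  have "{x, a} \<in> E" if "a \<in> U" for a
  proof (rule ccontr)
    assume "{x, a} \<notin> E"
    then have "card {a} + card U \<le> card (missing_to U {x, y})"
      by (intro card_missing_to_ge_two_stars) (use star assms that in auto)
    then show False using assms star by simp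
  qed
  then show ?thesis using star that by blast
qed

text \<open>A common edge would have to meet the three pairwise disjoint sets \<open>m\<close>,
  \<open>m'\<close> and \<open>S\<close> with only two vertices.\<close>

lemma missing_to_disjoint:
  assumes "m \<in> M" "m' \<in> M" "m \<noteq> m'" "S \<inter> m = {}" "S \<inter> m' = {}"
  shows "missing_to S m \<inter> missing_to S m' = {}"
proof (rule equals0I)
  fix e assume "e \<in> missing_to S m \<inter> missing_to S m'"
  then have e: "card e = 2" "e \<inter> m \<noteq> {}" "e \<inter> m' \<noteq> {}" "e \<inter> S \<noteq> {}"
    using card_missing_edge by (simp_all add: missing_to_def)
  have "m \<inter> S = {}" "m' \<inter> S = {}" using assms(4,5) by (simp_all add: Int_commute)
  with e M_disjoint[OF assms(1-3)] show False by (rule card_two_not_three_parts)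
qed

lemma all_edges_U_disjoint_missing_to: "m \<in> M \<Longrightarrow> all_edges U \<inter> missing_to S m = {}"
  using M_U_disjoint unfolding all_edges_def missing_to_def by blast

lemma card_missing_ge_sum:
  "(card U choose 2) + (\<Sum>m\<in>M. card (missing_to U m)) \<le> card missing"
proof -
  have "card (all_edges U) + card ({} :: 'a set set) + (\<Sum>m\<in>M. card (missing_to U m)) \<le> card missing"
  proof (rule card_ge_disjoint_UN[OF finite_missing finite_M all_edges_U_missing])
    fix m m' assume m: "m \<in> M" "m' \<in> M" "m \<noteq> m'"
    have "U \<inter> m = {}" "U \<inter> m' = {}" using m M_U_disjoint by (simp_all add: Int_commute)
    with m show "missing_to U m \<inter> missing_to U m' = {}" by (rule missing_to_disjoint)
  qed (simp_all add: missing_to_subset all_edges_U_disjoint_missing_to)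
  then show ?thesis using card_all_edges[OF finite_U] by simp
qed

section \<open>The bound 2n - 3 on missing edges, by the number of uncovered vertices\<close>

lemma card_missing_ge_U_large:
  assumes "card U \<ge> 5"
  shows "2 * card V - 3 \<le> card missing"
proof -
  \<comment> \<open>With k matching edges this gives 5k + 2u missing edges, at least 2n = 4k +
    2u.\<close>
  have "card M * 5 \<le> (\<Sum>m\<in>M. card (missing_to U m))"
    using card_missing_to_ge assms
    by (intro sum_bounded_below[where K = "5::nat", simplified]) force
  moreover have "2 * card U \<le> card U choose 2"
  proof -
    have "card U * 4 \<le> card U * (card U - 1)" using assms by (intro mult_left_mono) auto
    then show ?thesis unfolding choose_two by linarith
  qed
  ultimately show ?thesis using card_missing_ge_sum card_V by linarith
qed

text \<open>Here n = 2k + 3, so the target is 4k + 3. The three pairs inside \<open>U\<close> leave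
  an average of 4 to be found per matching edge. An edge \<open>m0\<close> with only 3 missing edges
  to \<open>U\<close> creates a deficit of one: every other matching edge reaches 4 with the help of
  \<open>y0\<close>, and one more missing edge is gained at or between two others, which is where k
  >= 3 enters.\<close>

lemma card_missing_ge_U_three:
  assumes U3: "card U = 3" and M3: "card M \<ge> 3"
  shows "2 * card V - 3 \<le> card missing"
proof (cases "\<forall>m\<in>M. card (missing_to U m) \<ge> 4")
  case True
  then have "card M * 4 \<le> (\<Sum>m\<in>M. card (missing_to U m))"
    by (intro sum_bounded_below[where K = "4::nat", simplified]) auto
  then show ?thesis using card_missing_ge_sum card_V U3 by (simp add: choose_two)
next
  case False
  then obtain m0 where m0: "m0 \<in> M" "card (missing_to U m0) \<le> 3" by force
  then obtain x0 y0 where xy0: "m0 = {x0, y0}" "x0 \<noteq> y0" "\<And>a. a \<in> U \<Longrightarrow> {x0, a} \<in> E"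
    using full_vertex U3 by (metis order_refl)
  \<comment> \<open>Missing edges from \<open>y0\<close> to another matching edge \<open>m\<close>
    are charged to \<open>m\<close>. At \<open>m0\<close> the set stays \<open>U\<close>, since
    \<open>y0\<close> lies in \<open>m0\<close> itself.\<close>
  define S where "S m = (if m = m0 then U else insert y0 U)" for m
  have S_dis: "S m' \<inter> m = {}" if "m \<in> M" "m \<noteq> m0" for m m'
    using that M_U_disjoint[of m] M_disjoint[OF that(1) m0(1)] xy0(1) by (auto simp: S_def)
  have dis: "missing_to (S m) m \<inter> missing_to (S m') m' = {}"
    if mm: "m \<in> M" "m' \<in> M" "m \<noteq> m'" for m m'
  proof -
    \<comment> \<open>An edge counted on both sides would meet \<open>m0\<close>, \<open>m\<close>
      and \<open>U\<close>, again too many disjoint sets for two vertices.\<close>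
    have *: "missing_to U m0 \<inter> missing_to (insert y0 U) m = {}" if "m \<in> M" "m \<noteq> m0" for m
    proof (rule equals0I)
      fix e assume "e \<in> missing_to U m0 \<inter> missing_to (insert y0 U) m"
      then have "card e = 2" "e \<inter> m0 \<noteq> {}" "e \<inter> m \<noteq> {}" "e \<inter> U \<noteq> {}"
        using card_missing_edge unfolding missing_to_def by blast+
      then show False
        using M_disjoint[OF m0(1) that(1)] that(2) M_U_disjoint[OF m0(1)] M_U_disjoint[OF that(1)]
        by (intro card_two_not_three_parts[of e m0 m U]) auto
    qed
    consider "m = m0" | "m' = m0" | "m \<noteq> m0" "m' \<noteq> m0" by blast
    then show ?thesis
    proof cases
      case 1 then show ?thesis using *[of m'] mm by (simp add: S_def)
    next
      case 2 then show ?thesis using *[of m] mm by (auto simp: S_def)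
    next
      case 3
      then show ?thesis
        using missing_to_disjoint[OF mm, of "insert y0 U"] S_dis[of m m] S_dis[of m' m'] mm
        by (simp add: S_def)
    qed
  qed
  \<comment> \<open>If an end \<open>p\<close> of \<open>m\<close> has a neighbour \<open>b\<close>
    in \<open>U\<close>, its other end \<open>q\<close> cannot be adjacent to \<open>y0\<close>: as
    \<open>x0\<close> is adjacent to all of \<open>U\<close>, some a distinct from b would start the
    augmenting path a, x0, y0, q, p, b. If neither end has a neighbour in \<open>U\<close>, all 6
    edges to \<open>U\<close> are missing.\<close>
  have extra: "card (missing_to U m) + 1 \<le> card (missing_to (S m) m) \<or> 6 \<le> card (missing_to (S m) m)"
    if m: "m \<in> M" "m \<noteq> m0" for m
  proof -
    have sub: "missing_to U m \<subseteq> missing_to (S m) m"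
      using m unfolding missing_to_def S_def by auto
    obtain x y where xy: "m = {x, y}" "x \<noteq> y" "x \<in> V" "y \<in> V" "x \<notin> U" "y \<notin> U"
      using M_edgeE[OF m(1)] by metis
    have step: "card (missing_to U m) + 1 \<le> card (missing_to (S m) m)"
      if pq: "m = {p, q}" "b \<in> U" "{p, b} \<in> E" for p q b
    proof -
      obtain a where a: "a \<in> U" "a \<noteq> b"
        using U3 by (auto simp: numeral_3_eq_3 card_Suc_eq)
      have "{y0, q} \<notin> E"
        using no_augmenting_path_5[of x0 y0 p q a b] m0(1) m pq a xy0 by simp
      moreover have "q \<in> V" "y0 \<in> V" "y0 \<notin> m" "y0 \<notin> U"
        using M_in_V m m0 pq xy0(1) M_disjoint[OF m(1) m0(1)] M_U_disjoint[OF m0(1)] by auto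
      ultimately have "{y0, q} \<in> missing_to (S m) m" "{y0, q} \<notin> missing_to U m"
        using pair_missing[of y0 q] pq m(2) M_U_disjoint[OF m(1)]
        by (auto simp: missing_to_def S_def)
      then have "missing_to U m \<subset> missing_to (S m) m" using sub by blast
      from psubset_card_mono[OF finite_missing_to this] show ?thesis by simp
    qed
    show ?thesis
    proof (cases "\<exists>b\<in>U. {x, b} \<in> E \<or> {y, b} \<in> E")
      case True
      then show ?thesis using step xy(1) by (metis insert_commute)
    next
      case False
      then have "card U + card U \<le> card (missing_to U m)"
        using card_missing_to_ge_two_stars[of x y U U] xy m(1) by auto
      also have "\<dots> \<le> card (missing_to (S m) m)"
        by (rule card_mono[OF finite_missing_to sub])
      finally show ?thesis using U3 by simp
    qed
  qed
  have ge4: "4 \<le> card (missing_to (S m) m)" if "m \<in> M - {m0}" for m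
    using extra[of m] card_missing_to_ge[of m] that U3 by force
  have ge3: "3 \<le> card (missing_to (S m0) m0)"
    using card_missing_to_ge[of m0] m0 U3 by (simp add: S_def)
  \<comment> \<open>The leading 3 counts the pairs inside \<open>U\<close>. The set \<open>B\<close>
    will be empty in the first case below and a single edge in the second.\<close>
  have total: "3 + card B + (\<Sum>m\<in>M. card (missing_to (S m) m)) \<le> card missing"
    if B: "B \<subseteq> missing" "\<And>e. e \<in> B \<Longrightarrow> e \<inter> insert y0 U = {}" for B
  proof -
    have "card (all_edges U) + card B + (\<Sum>m\<in>M. card (missing_to (S m) m)) \<le> card missing"
    proof (rule card_ge_disjoint_UN[OF finite_missing finite_M all_edges_U_missing])
      show "all_edges U \<inter> B = {}"
      proof -
        have "e \<inter> U \<noteq> {}" if "e \<in> all_edges U" for e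
          using that by (auto simp: all_edges_def Int_absorb2)
        then show ?thesis using B(2) by blast
      qed
      show "B \<inter> missing_to (S m) m = {}" for m
        using B(2) unfolding missing_to_def S_def by auto
    qed (use B missing_to_subset dis all_edges_U_disjoint_missing_to in auto)
    then show ?thesis using card_all_edges[OF finite_U] U3 by (simp add: choose_two)
  qed
  have sum_split: "(\<Sum>m\<in>M. card (missing_to (S m) m)) =
      card (missing_to (S m0) m0) + (\<Sum>m\<in>M - {m0}. card (missing_to (S m) m))"
    using finite_M m0(1) by (rule sum.remove)
  have cardM0: "card (M - {m0}) = card M - 1" using m0 finite_M by simp
  show ?thesis
  proof (cases "\<exists>m1\<in>M - {m0}. card (missing_to U m1) \<ge> 4")
    case True
    then obtain m1 where m1: "m1 \<in> M - {m0}" "card (missing_to U m1) \<ge> 4" by blast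
    \<comment> \<open>The surplus at \<open>m1\<close> makes up for the deficit at
      \<open>m0\<close>: 3 + 3 + 5 + 4(k - 2) = 4k + 3.\<close>
    then have "5 \<le> card (missing_to (S m1) m1)" using extra[of m1] by force
    moreover have "(\<Sum>m\<in>M - {m0}. card (missing_to (S m) m)) =
        card (missing_to (S m1) m1) + (\<Sum>m\<in>M - {m0} - {m1}. card (missing_to (S m) m))"
      using finite_M m1(1) by (intro sum.remove) auto
    moreover have "card (M - {m0} - {m1}) * 4 \<le> (\<Sum>m\<in>M - {m0} - {m1}. card (missing_to (S m) m))"
      using ge4 by (intro sum_bounded_below[where K = "4::nat", simplified]) auto
    moreover have "card (M - {m0} - {m1}) = card M - 2" using m1 finite_M cardM0 by simp
    ultimately show ?thesis using total[of "{}"] sum_split ge3 card_V U3 M3 by simp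
  next
    case False
    have "2 \<le> card (M - {m0})" using cardM0 M3 by simp
    then obtain m1 m2 where m12: "m1 \<in> M - {m0}" "m2 \<in> M - {m0}" "m1 \<noteq> m2"
      by (meson card_2_iff' obtain_subset_with_card_n subsetD)
    have small: "card (missing_to U m1) \<le> card U" "card (missing_to U m2) \<le> card U"
      using False m12 U3 by force+
    obtain x1 y1 where 1: "m1 = {x1, y1}" "\<And>a. a \<in> U \<Longrightarrow> {x1, a} \<in> E"
      using full_vertex[of m1] small m12 U3 by (metis DiffD1 order_refl)
    obtain x2 y2 where 2: "m2 = {x2, y2}" "\<And>a. a \<in> U \<Longrightarrow> {x2, a} \<in> E"
      using full_vertex[of m2] small m12 U3 by (metis DiffD1 order_refl)
    obtain a b where ab: "a \<in> U" "b \<in> U" "a \<noteq> b"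
      using U3 by (auto simp: numeral_3_eq_3 card_Suc_eq)
    \<comment> \<open>Both \<open>x1\<close> and \<open>x2\<close> are adjacent to all of
      \<open>U\<close>, so the path a, x1, y1, y2, x2, b would be augmenting. The missing edge
      \<open>{y1, y2}\<close> avoids \<open>U\<close> and \<open>y0\<close>, hence has not been
      counted yet: 3 + 1 + 3 + 4(k - 1) = 4k + 3.\<close>
    have "{y1, y2} \<notin> E"
      using no_augmenting_path_5[of x1 y1 x2 y2 a b] 1 2 m12 ab by auto
    moreover have "y1 \<noteq> y2" "y1 \<in> V" "y2 \<in> V"
      using M_disjoint[of m1 m2] m12 1(1) 2(1) M_in_V by auto
    ultimately have "{y1, y2} \<in> missing" by (intro pair_missing)
    moreover have "{y1, y2} \<inter> insert y0 U = {}"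
      using S_dis[of m1 m1] S_dis[of m2 m2] m12 1(1) 2(1) by (auto simp: S_def)
    ultimately have "3 + card {{y1, y2}} + (\<Sum>m\<in>M. card (missing_to (S m) m)) \<le> card missing"
      by (intro total) auto
    moreover have "card (M - {m0}) * 4 \<le> (\<Sum>m\<in>M - {m0}. card (missing_to (S m) m))"
      using ge4 by (intro sum_bounded_below[where K = "4::nat", simplified]) auto
    ultimately show ?thesis using sum_split ge3 card_V U3 M3 cardM0 by simp
  qed
qed

end

section \<open>Graphs without an almost-perfect matching\<close>

lemma maximum_matching_exists:
  assumes "finite V" "E \<subseteq> all_edges V"
  shows "\<exists>M. maximum_matching V E M"
proof -
  let ?P = "\<lambda>M. M \<subseteq> E \<and> pairwise disjnt M"
  have "finite E" using assms finite_all_edges finite_subset by blast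
  then have "\<forall>M. ?P M \<longrightarrow> card M < Suc (card E)" by (simp add: card_mono less_Suc_eq_le)
  moreover have "?P {}" by simp
  ultimately obtain M where "?P M" "\<forall>M'. ?P M' \<longrightarrow> card M' \<le> card M"
    using ex_has_greatest_nat[of ?P "{}" card "Suc (card E)"] by blast
  then show ?thesis using assms by (auto simp: maximum_matching_def)
qed

text \<open>The number of uncovered vertices is odd, and 1 would mean an almost-perfect matching.
  For 3 uncovered vertices, n >= 9 gives the three matching edges required. On 7 vertices the bound
  fails: two vertices joined to each other and to five independent ones miss only 10 edges.\<close>

lemma card_missing_edges_ge:
  assumes G: "simple_graph G" and n: "odd (card (verts G))" "card (verts G) \<ge> 9"
    and none: "\<nexists>M. almost_perfect_matching G M"
  shows "2 * card (verts G) - 3 \<le> card (all_edges (verts G) - edges G)"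
proof -
  obtain M where "maximum_matching (verts G) (edges G) M"
    using maximum_matching_exists G unfolding simple_graph_def by blast
  then interpret maximum_matching "verts G" "edges G" M .
  have "card U \<noteq> 1"
  proof
    assume "card U = 1"
    then obtain w where w: "U = {w}" by (auto simp: card_1_singleton_iff)
    have "\<exists>!e. e \<in> M \<and> v \<in> e" if "v \<in> verts G - {w}" for v
      using that w M_disjoint unfolding U_def by blast
    moreover have "w \<in> verts G" "\<forall>e\<in>M. w \<notin> e" using w unfolding U_def by auto
    ultimately have "almost_perfect_matching G M"
      unfolding almost_perfect_matching_def by (intro conjI M_subset bexI[of _ w] ballI) auto
    then show False using none by blast
  qed
  moreover have "odd (card U)" using n card_V by simp
  ultimately have "card U = 3 \<or> card U \<ge> 5" by presburger
  then consider "card U = 3" | "card U \<ge> 5" by blast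
  then show ?thesis
  proof cases
    case 1
    then show ?thesis using card_missing_ge_U_three n card_V unfolding missing_def by simp
  next
    case 2
    then show ?thesis using card_missing_ge_U_large unfolding missing_def by simp
  qed
qed

section \<open>Bounds on the matching preclusion number\<close>

lemma card_edges_touching_pair:
  assumes "finite V" "u \<in> V" "v \<in> V" "u \<noteq> v"
  shows "card {e \<in> all_edges V. e \<inter> {u, v} \<noteq> {}} = 2 * card V - 3"
proof -
  \<comment> \<open>The star at \<open>v\<close> leaves out \<open>u\<close>, so that the edge
    \<open>{u, v}\<close> is counted once.\<close>
  have "{e \<in> all_edges V. e \<inter> {u, v} \<noteq> {}} =
      (\<lambda>a. {u, a}) ` (V - {u}) \<union> (\<lambda>a. {v, a}) ` (V - {u, v})" (is "?L = ?A \<union> ?B")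
  proof
    show "?L \<subseteq> ?A \<union> ?B"
    proof
      fix e assume e: "e \<in> ?L"
      then obtain p q where pq: "e = {p, q}" "p \<noteq> q" "p \<in> V" "q \<in> V"
        by (auto simp: all_edges_def card_2_iff)
      then show "e \<in> ?A \<union> ?B" using e by (auto simp: image_iff doubleton_eq_iff)
    qed
    show "?A \<union> ?B \<subseteq> ?L" using assms by (auto simp: pair_in_all_edges)
  qed
  also have "card \<dots> = card ?A + card ?B"
    by (rule card_Un_disjoint) (use assms in \<open>auto simp: doubleton_eq_iff\<close>)
  also have "\<dots> = card (V - {u}) + card (V - {u, v})"
    by (subst (1 2) card_pair_image) auto
  also have "\<dots> = (card V - 1) + (card V - 2)" using assms by (simp add: card_Diff_subset)
  also have "\<dots> = 2 * card V - 3"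
    using card_mono[of V "{u, v}"] assms by simp
  finally show ?thesis .
qed

text \<open>Both vertices become isolated, while an almost-perfect matching may skip only
  one.\<close>

lemma matching_precluding_touching_pair:
  assumes "u \<in> verts G" "v \<in> verts G" "u \<noteq> v"
  shows "matching_precluding G {e \<in> edges G. e \<inter> {u, v} \<noteq> {}}"
proof -
  define H where "H = delete_edges G {e \<in> edges G. e \<inter> {u, v} \<noteq> {}}"
  have isolated: "u \<notin> e" "v \<notin> e" if "e \<in> edges H" for e
    using that by (auto simp: H_def delete_edges_def)
  have "\<not> perfect_matching H M" for M
  proof
    assume M: "perfect_matching H M"
    then have "M \<subseteq> edges H" and "\<exists>!e. e \<in> M \<and> u \<in> e"
      using assms(1) by (simp_all add: perfect_matching_def H_def delete_edges_def)
    then obtain e where "e \<in> edges H" "u \<in> e" by blast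
    then show False using isolated(1) by simp
  qed
  moreover have "\<not> almost_perfect_matching H M" for M
  proof
    assume "almost_perfect_matching H M"
    then obtain w where M: "M \<subseteq> edges H" and w: "\<forall>x\<in>verts H - {w}. \<exists>!e. e \<in> M \<and> x \<in> e"
      unfolding almost_perfect_matching_def by (elim conjE bexE)
    obtain x where x: "x \<in> {u, v}" "x \<noteq> w" using assms(3) by auto
    then have "x \<in> verts H - {w}" using assms(1,2) by (auto simp: H_def delete_edges_def)
    with w have "\<exists>!e. e \<in> M \<and> x \<in> e" by (rule bspec)
    with M obtain e where "e \<in> edges H" "x \<in> e" by blast
    then show False using isolated x(1) by blast
  qed
  ultimately show ?thesis unfolding matching_precluding_def H_def by blast
qed

text \<open>Each edge already missing at \<open>u\<close> or \<open>v\<close> saves one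
  deletion.\<close>

lemma mp_upper:
  assumes G: "simple_graph G" and uv: "u \<in> verts G" "v \<in> verts G" "u \<noteq> v"
  shows "mp G + card {e \<in> all_edges (verts G) - edges G. e \<inter> {u, v} \<noteq> {}} \<le> 2 * card (verts G) - 3"
proof -
  let ?V = "verts G"
  let ?F = "{e \<in> edges G. e \<inter> {u, v} \<noteq> {}}"
  let ?N = "{e \<in> all_edges ?V - edges G. e \<inter> {u, v} \<noteq> {}}"
  have "finite (all_edges ?V)" "edges G \<subseteq> all_edges ?V"
    using G finite_all_edges by (auto simp: simple_graph_def)
  moreover from this have "finite (edges G)" using finite_subset by blast
  ultimately have "card (?F \<union> ?N) = card ?F + card ?N" by (intro card_Un_disjoint) auto
  moreover have "?F \<union> ?N = {e \<in> all_edges ?V. e \<inter> {u, v} \<noteq> {}}"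
    using \<open>edges G \<subseteq> all_edges ?V\<close> by blast
  moreover have "mp G \<le> card ?F"
    unfolding mp_def by (rule Least_le) (use matching_precluding_touching_pair[OF uv] in auto)
  ultimately show ?thesis
    using card_edges_touching_pair[of ?V u v] G uv by (simp add: simple_graph_def)
qed

text \<open>An optimal precluding set together with the edges missing from \<open>G\<close> is
  exactly what the remaining graph misses, so \<open>card_missing_edges_ge\<close> applies to that
  graph.\<close>

lemma mp_lower:
  assumes G: "simple_graph G" and n: "odd (card (verts G))" "card (verts G) \<ge> 9"
  shows "2 * card (verts G) - 3 \<le> mp G + card (all_edges (verts G) - edges G)"
proof -
  let ?V = "verts G"
  have fin: "finite ?V" "edges G \<subseteq> all_edges ?V" using G by (auto simp: simple_graph_def)
  obtain S where "S \<subseteq> ?V" "card S = 2"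
    using obtain_subset_with_card_n[of 2 ?V] n(2) by auto
  then obtain u v where "u \<in> ?V" "v \<in> ?V" "u \<noteq> v" by (auto simp: card_2_iff)
  from matching_precluding_touching_pair[OF this]
  \<comment> \<open>The \<open>LEAST\<close> in \<open>mp\<close> is attained only once some
    precluding set is known to exist.\<close>
  have "\<exists>k F. matching_precluding G F \<and> card F = k" by auto
  from LeastI_ex[OF this] have "\<exists>F. matching_precluding G F \<and> card F = mp G"
    unfolding mp_def .
  then obtain F where F: "matching_precluding G F" "card F = mp G" by blast
  have "2 * card ?V - 3 \<le> card (all_edges ?V - (edges G - F))"
    using card_missing_edges_ge[of "delete_edges G F"] F(1) fin n
    by (auto simp: matching_precluding_def delete_edges_def simple_graph_def)
  also have "all_edges ?V - (edges G - F) = F \<union> (all_edges ?V - edges G)"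
    using F(1) fin(2) by (auto simp: matching_precluding_def)
  also have "card \<dots> \<le> mp G + card (all_edges ?V - edges G)"
    using card_Un_le F(2) by metis
  finally show ?thesis .
qed

theorem theorem3p8:
  fixes G :: "'a ugraph" and n :: nat
  assumes "simple_graph G"
    and "card (verts G) = n"
    and "odd n"
    and "n \<ge> 9"
  shows "mp G = 2 * n - 4 \<longleftrightarrow>
    (\<exists>e \<in> edges (complete_graph (verts G)). G = delete_edges (complete_graph (verts G)) {e})"
proof
  let ?V = "verts G"
  let ?N = "all_edges ?V - edges G"
  have fin: "finite ?V" "edges G \<subseteq> all_edges ?V" "finite ?N"
    using assms(1) finite_all_edges by (auto simp: simple_graph_def)
  have lower: "2 * n - 3 \<le> mp G + card ?N" using mp_lower assms by blast
  {
    assume mp: "mp G = 2 * n - 4"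
    have "?N \<noteq> {}" using lower mp assms(4) by force
    then obtain e where e: "e \<in> ?N" by blast
    \<comment> \<open>Two distinct missing edges could be met by distinct vertices \<open>u\<close>
      and \<open>v\<close>, since \<open>f\<close> has an end other than \<open>u\<close>; then
      \<open>mp_upper\<close> would give at most 2n - 5.\<close>
    have "f = e" if f: "f \<in> ?N" for f
    proof (rule ccontr)
      assume "f \<noteq> e"
      from e obtain u where u: "u \<in> e" "u \<in> ?V" by (force simp: all_edges_def card_2_iff)
      from f obtain v where v: "v \<in> f" "v \<in> ?V" "u \<noteq> v" by (force simp: all_edges_def card_2_iff)
      have "card {e, f} \<le> card {e \<in> ?N. e \<inter> {u, v} \<noteq> {}}"
      proof (rule card_mono)
        show "finite {e \<in> ?N. e \<inter> {u, v} \<noteq> {}}"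
          by (rule finite_subset[OF _ fin(3)]) blast
        show "{e, f} \<subseteq> {e \<in> ?N. e \<inter> {u, v} \<noteq> {}}" using e f u(1) v(1) by auto
      qed
      then show False
        using mp_upper[OF assms(1) u(2) v(2,3)] mp \<open>f \<noteq> e\<close> assms(2,4) by simp
    qed
    with e have "?N = {e}" by blast
    then have "edges G = all_edges ?V - {e}" using fin(2) by blast
    then have "G = delete_edges (complete_graph ?V) {e}"
      by (simp add: delete_edges_def complete_graph_def)
    then show "\<exists>e \<in> edges (complete_graph ?V). G = delete_edges (complete_graph ?V) {e}"
      using e by (auto simp: complete_graph_def)
  }
  {
    assume "\<exists>e \<in> edges (complete_graph ?V). G = delete_edges (complete_graph ?V) {e}"
    then obtain e where e: "e \<in> all_edges ?V" "G = delete_edges (complete_graph ?V) {e}"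
      by (auto simp: complete_graph_def)
    have "edges G = all_edges ?V - {e}"
      by (subst e(2)) (simp add: delete_edges_def complete_graph_def)
    then have N: "?N = {e}" using e(1) by blast
    obtain u v where uv: "e = {u, v}" "u \<in> ?V" "v \<in> ?V" "u \<noteq> v"
      using e(1) by (force simp: all_edges_def card_2_iff)
    \<comment> \<open>Choosing the ends of the one missing edge makes the upper bound 2n - 4, which
      agrees with \<open>lower\<close>.\<close>
    have "{f \<in> ?N. f \<inter> {u, v} \<noteq> {}} = {e}" unfolding N using uv(1) by auto
    then show "mp G = 2 * n - 4"
      using mp_upper[OF assms(1) uv(2-4)] lower N assms(2) by simp
  }
qed

end
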